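(* Let $\Sigma=(A,B,C,D)$ be a real linear time-invariant system with state dimension $n$ and $m$ inputs and outputs that is passive, minimal and asymptotically stable. Let $X_{\min}$ be the minimal solution of the KYP inequality $\mathcal W(X)\ge 0$ of $\Sigma$ and let $\Sigma_H=(A,B,L,M)$ be a spectral factor of $\Sigma$ associated with $X_{\min}$. Then for any solution $X=X^\top$ of the KYP inequality $\mathcal W(X)\ge0$ and any spectral factor $\Sigma_{\hat H}=(A,B,\hat L,\hat M)$ of $\Sigma$ associated with $X$, $$\sigma_k(\Sigma_H)\le\sigma_k(\Sigma_{\hat H}),\qquad k=1,\dots,n,$$ where $\sigma_k(\cdot)$ denotes the $k$-th Hankel singular value of the respective system.
   Context: A system $(A,B,C,D)$ with $A\in\mathbb R^{n\times n}$, $B\in\mathbb R^{n\times m}$, $C\in\mathbb R^{p\times n}$, $D\in\mathbb R^{p\times m}$ means $\dot x=Ax+Bu$, $y=Cx+Du$. It is minimal if $\operatorname{rank}[sI_n-A,\ B]=n=\operatorname{rank}[sI_n-A^\top,\ C^\top]$ for all $s\in\mathbb C$, and asymptotically stable if all eigenvalues of $A$ have negative real part. For $p=m$, the system is passive if there is a function $\mathcal H:\mathbb R^n\to[0,\infty)$ (storage function) such that $\mathcal H(x(t_1))-\mathcal H(x(t_0))\le\int_{t_0}^{t_1}y(\tau)^\top u(\tau)\,d\tau$ for all $t_1\ge t_0$ and all trajectories $(u,x,y)$ of the system. For $X=X^\top\in\mathbb R^{n\times n}$ put $$\mathcal W(X)=\begin{bmatrix}-A^\top X-XA & C^\top-XB\\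 C-B^\top X & D+D^\top\end{bmatrix};$$ the KYP inequality is $\mathcal W(X)\ge0$ (positive semidefinite), and solutions are understood to be symmetric. The minimal solution $X_{\min}$ is the symmetric solution of the KYP inequality satisfying $X_{\min}\le X$ (Loewner order) for every symmetric solution $X$; it is a known fact that it exists for passive, minimal, asymptotically stable systems. A spectral factor of $\Sigma$ associated with a solution $X$ of the KYP inequality is a system $(A,B,L,M)$ with $L\in\mathbb R^{q\times n}$, $M\in\mathbb R^{q\times m}$ (for some $q$) such that $\mathcal W(X)=[L\ \ M]^\top[L\ \ M]$. The Hankel singular values of an asymptotically stable system $(A,B,L,M)$ are $\sigma_k=\sqrt{\lambda_k(\mathcal P\mathcal Q)}$, $k=1,\dots,n$, where $\mathcal P,\mathcal Q$ are the controllability and observability Gramians, i.e. the unique solutions of $A\mathcal P+\mathcal PA^\top+BB^\top=0$ and $A^\top\mathcal Q+\mathcal QA+L^\top L=0$, and the eigenvalues $\lambda_k$ (which are real and nonnegative) are counted with multiplicity and listed in nonincreasing order. *)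

theory Defs
  imports
    "HOL-Analysis.Henstock_Kurzweil_Integration"
    "Jordan_Normal_Form.Char_Poly"
    "Jordan_Normal_Form.DL_Rank"
begin

(* The vector syntax below is that of Jordan_Normal_Form, whose vectors and matrices carry their
   dimensions as natural numbers. *)
unbundle no vec_syntax

abbreviation complex_mat :: "real mat \<Rightarrow> complex mat" where
  "complex_mat \<equiv> map_mat complex_of_real"

definition append_cols :: "'a :: zero mat \<Rightarrow> 'a mat \<Rightarrow> 'a mat" where
  "append_cols M N = four_block_mat M N (0\<^sub>m 0 (dim_col M)) (0\<^sub>m 0 (dim_col N))"


definition lti_system ::
  "nat \<Rightarrow> nat \<Rightarrow> nat \<Rightarrow> real mat \<Rightarrow> real mat \<Rightarrow> real mat \<Rightarrow> real mat \<Rightarrow> bool" where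
  "lti_system n m p A B C D \<longleftrightarrow>
     A \<in> carrier_mat n n \<and> B \<in> carrier_mat n m \<and> C \<in> carrier_mat p n \<and> D \<in> carrier_mat p m"

definition minimal_system :: "nat \<Rightarrow> real mat \<Rightarrow> real mat \<Rightarrow> real mat \<Rightarrow> bool" where
  "minimal_system n A B C \<longleftrightarrow>
     (\<forall>s :: complex.
        vec_space.rank n (append_cols (s \<cdot>\<^sub>m 1\<^sub>m n - complex_mat A) (complex_mat B)) = n \<and>
        vec_space.rank n (append_cols (s \<cdot>\<^sub>m 1\<^sub>m n - complex_mat A\<^sup>T) (complex_mat C\<^sup>T)) = n)"

definition asymptotically_stable :: "real mat \<Rightarrow> bool" where
  "asymptotically_stable A \<longleftrightarrow> (\<forall>z. eigenvalue (complex_mat A) z \<longrightarrow> Re z < 0)"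


(* Classical trajectories on the whole time axis: continuous input, differentiable state.
   Admitting fewer trajectories makes passivity a weaker requirement, so a system that is passive
   for a larger class (e.g. locally square-integrable inputs) is also passive in the sense below. *)
definition trajectory ::
  "nat \<Rightarrow> nat \<Rightarrow> nat \<Rightarrow> real mat \<Rightarrow> real mat \<Rightarrow> real mat \<Rightarrow> real mat \<Rightarrow>
   (real \<Rightarrow> real vec) \<Rightarrow> (real \<Rightarrow> real vec) \<Rightarrow> (real \<Rightarrow> real vec) \<Rightarrow> bool" where
  "trajectory n m p A B C D u x y \<longleftrightarrow>
     (\<forall>t. u t \<in> carrier_vec m \<and> x t \<in> carrier_vec n \<and> y t \<in> carrier_vec p) \<and>
     (\<forall>i<m. continuous_on UNIV (\<lambda>t. u t $ i)) \<and>
     (\<forall>t. \<forall>i<n. ((\<lambda>s. x s $ i) has_real_derivative (A *\<^sub>v x t + B *\<^sub>v u t) $ i) (at t)) \<and>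
     (\<forall>t. y t = C *\<^sub>v x t + D *\<^sub>v u t)"

definition passive_system ::
  "nat \<Rightarrow> nat \<Rightarrow> real mat \<Rightarrow> real mat \<Rightarrow> real mat \<Rightarrow> real mat \<Rightarrow> bool" where
  "passive_system n m A B C D \<longleftrightarrow>
     (\<exists>H :: real vec \<Rightarrow> real.
        (\<forall>\<xi> \<in> carrier_vec n. 0 \<le> H \<xi>) \<and>
        (\<forall>u x y t0 t1. trajectory n m m A B C D u x y \<longrightarrow> t0 \<le> t1 \<longrightarrow>
           H (x t1) - H (x t0) \<le> integral {t0..t1} (\<lambda>\<tau>. y \<tau> \<bullet> u \<tau>)))"


definition psd :: "nat \<Rightarrow> real mat \<Rightarrow> bool" where
  "psd n M \<longleftrightarrow> M \<in> carrier_mat n n \<and> M\<^sup>T = M \<and> (\<forall>v \<in> carrier_vec n. 0 \<le> v \<bullet> (M *\<^sub>v v))"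

definition kyp_mat ::
  "real mat \<Rightarrow> real mat \<Rightarrow> real mat \<Rightarrow> real mat \<Rightarrow> real mat \<Rightarrow> real mat" where
  "kyp_mat A B C D X =
     four_block_mat (- (A\<^sup>T * X) - X * A) (C\<^sup>T - X * B)
                    (C - B\<^sup>T * X)          (D + D\<^sup>T)"

definition kyp_solution ::
  "nat \<Rightarrow> nat \<Rightarrow> real mat \<Rightarrow> real mat \<Rightarrow> real mat \<Rightarrow> real mat \<Rightarrow> real mat \<Rightarrow> bool" where
  "kyp_solution n m A B C D X \<longleftrightarrow>
     X \<in> carrier_mat n n \<and> X\<^sup>T = X \<and> psd (n + m) (kyp_mat A B C D X)"

definition minimal_kyp_solution ::
  "nat \<Rightarrow> nat \<Rightarrow> real mat \<Rightarrow> real mat \<Rightarrow> real mat \<Rightarrow> real mat \<Rightarrow> real mat \<Rightarrow> bool" where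
  "minimal_kyp_solution n m A B C D X\<^sub>0 \<longleftrightarrow>
     kyp_solution n m A B C D X\<^sub>0 \<and>
     (\<forall>X. kyp_solution n m A B C D X \<longrightarrow> psd n (X - X\<^sub>0))"

definition spectral_factor ::
  "nat \<Rightarrow> nat \<Rightarrow> nat \<Rightarrow> real mat \<Rightarrow> real mat \<Rightarrow> real mat \<Rightarrow> real mat \<Rightarrow> real mat \<Rightarrow>
   real mat \<Rightarrow> real mat \<Rightarrow> bool" where
  "spectral_factor n m q A B C D X L M \<longleftrightarrow>
     lti_system n m q A B L M \<and>
     kyp_mat A B C D X = (append_cols L M)\<^sup>T * append_cols L M"


definition controllability_gramian :: "nat \<Rightarrow> real mat \<Rightarrow> real mat \<Rightarrow> real mat" where
  "controllability_gramian n A B =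
     (THE P. P \<in> carrier_mat n n \<and> A * P + P * A\<^sup>T + B * B\<^sup>T = 0\<^sub>m n n)"

definition observability_gramian :: "nat \<Rightarrow> real mat \<Rightarrow> real mat \<Rightarrow> real mat" where
  "observability_gramian n A L =
     (THE Q. Q \<in> carrier_mat n n \<and> A\<^sup>T * Q + Q * A + L\<^sup>T * L = 0\<^sub>m n n)"

(* Real eigenvalues with algebraic multiplicity, in nonincreasing order; the list has length n
   exactly when all eigenvalues of the n x n matrix are real. *)
definition sorted_eigenvalues :: "real mat \<Rightarrow> real list" where
  "sorted_eigenvalues M = rev (sorted_list_of_multiset (proots (char_poly M)))"

(* The index k runs from 1 to n; the feedthrough matrix does not enter. *)
definition hankel_singular_value ::
  "nat \<Rightarrow> real mat \<Rightarrow> real mat \<Rightarrow> real mat \<Rightarrow> nat \<Rightarrow> real" where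
  "hankel_singular_value n A B L k =
     sqrt (sorted_eigenvalues (controllability_gramian n A B * observability_gramian n A L) ! (k - 1))"

end

theory Submission
  imports Defs "Jordan_Normal_Form.Spectral_Radius"
begin

unbundle no inner_syntax

text \<open>The upper left block of \<open>\<W>(X) = [L M]\<^sup>T [L M]\<close> says \<open>A\<^sup>T X + X A + L\<^sup>T L = 0\<close>, so the solution
  \<open>X\<close> itself is the observability Gramian of any spectral factor associated with it. All these
  factors share the controllability Gramian \<open>P = R R\<^sup>T\<close>, and \<open>P X\<close> has the eigenvalues of the
  symmetric matrix \<open>R\<^sup>T X R\<close>, which grow with \<open>X\<close> in the Loewner order.\<close>

section \<open>Sylvester equations and characteristic polynomials\<close>

text \<open>Gramians are definite descriptions, so identifying one takes existence and uniqueness.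
  Uniqueness is a Sylvester argument: the spectrum of \<open>A\<close> lies in the open left half
  plane and that of \<open>-A\<^sup>T\<close> in the open right one, so they are disjoint. For
  observability, existence is free because \<open>X\<close> is at hand; for controllability a
  solution must be built, and it must be positive semidefinite for the factor \<open>R\<close> to
  exist. A convergent series of positive semidefinite terms gives both at once. It solves a
  discrete-time (Stein) equation, which a Cayley transform of \<open>A\<close> makes available. The
  product \<open>P X\<close> is in general not symmetric, so quadratic forms do not bound its
  eigenvalues directly. The passage to \<open>R\<^sup>T X R\<close> therefore goes through
  characteristic polynomials, which keep algebraic multiplicities. For a symmetric matrix this
  polynomial splits over the reals, so the sorted list has full length and indexing it is
  meaningful.\<close>

lemma sylvester_unique:
  fixes A B Z :: "complex mat"
  assumes A: "A \<in> carrier_mat n n" and B: "B \<in> carrier_mat n n" and Z: "Z \<in> carrier_mat n n"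
    and eq: "A * Z = - (Z * B)"
    and disj: "\<And>z. eigenvalue B z \<Longrightarrow> \<not> eigenvalue A (- z)"
  shows "Z = 0\<^sub>m n n"
proof -
  \<comment> \<open>A Schur form \<open>B = P * T * Q\<close> turns the equation into
    \<open>A * W = - (W * T)\<close> for \<open>W = Z * P\<close>, with \<open>T\<close> upper
    triangular; it can then be solved column by column.\<close>
  obtain es where cp: "char_poly B = (\<Prod>e\<leftarrow>es. [:- e, 1:])"
    using char_poly_factorized[OF B] by blast
  obtain T P Q where "schur_decomposition B es = (T, P, Q)"
    by (cases "schur_decomposition B es")
  from schur_decomposition[OF B cp this]
  have sim: "similar_mat_wit B T P Q" and ut: "upper_triangular T" and dg: "diag_mat T = es"
    by auto
  from similar_mat_witD2[OF B sim]
  have PQ: "P * Q = 1\<^sub>m n" and QP: "Q * P = 1\<^sub>m n" and BT: "B = P * T * Q"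
    and T: "T \<in> carrier_mat n n" and P: "P \<in> carrier_mat n n" and Q: "Q \<in> carrier_mat n n"
    by auto
  define W where "W = Z * P"
  have W: "W \<in> carrier_mat n n" using Z P by (simp add: W_def)
  have "B * P = (P * T) * (Q * P)"
    unfolding BT by (rule assoc_mult_mat) (use P T Q in auto)
  then have BP: "B * P = P * T" using P T by (simp add: QP)
  have "A * W = A * Z * P" by (simp add: W_def assoc_mult_mat[OF A Z P])
  also have "\<dots> = - (Z * (P * T))"
    using Z B P by (simp add: eq assoc_mult_mat[OF Z B P] BP)
  finally have AW: "A * W = - (W * T)" by (simp add: W_def assoc_mult_mat[OF Z P T])
  \<comment> \<open>In column \<open>j\<close> of \<open>W * T\<close> the earlier columns of
    \<open>W\<close> vanish by induction and the later ones meet zeros of \<open>T\<close>. What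
    remains says that a nonzero column would be an eigenvector of \<open>A\<close> for
    \<open>- T $$ (j, j)\<close>, while \<open>T $$ (j, j)\<close> is an eigenvalue of
    \<open>B\<close>.\<close>
  have "col W j = 0\<^sub>v n" if "j < n" for j
    using that
  proof (induction j rule: less_induct)
    case (less j)
    have "A *\<^sub>v col W j = col (A * W) j"
      using less.prems A W by auto
    also have "\<dots> = (- T $$ (j, j)) \<cdot>\<^sub>v col W j"
    proof (rule eq_vecI)
      fix k assume "k < dim_vec ((- T $$ (j, j)) \<cdot>\<^sub>v col W j)"
      then have k: "k < n" using W by simp
      have "(\<Sum>i = 0..<n. W $$ (k, i) * T $$ (i, j)) = (\<Sum>i = 0..<n. if i = j then W $$ (k, j) * T $$ (j, j) else 0)"
      proof (rule sum.cong[OF refl])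
        fix i assume i: "i \<in> {0..<n}"
        consider "i < j" | "i = j" | "j < i" by linarith
        then show "W $$ (k, i) * T $$ (i, j) = (if i = j then W $$ (k, j) * T $$ (j, j) else 0)"
        proof cases
          case 1
          then have "col W i $ k = 0" using less.IH[of i] i k by simp
          then show ?thesis using 1 i k W by simp
        next
          case 3
          then have "T $$ (i, j) = 0" using ut i T by auto
          then show ?thesis using 3 by simp
        qed simp
      qed
      also have "\<dots> = W $$ (k, j) * T $$ (j, j)" using less.prems by simp
      finally show "col (A * W) j $ k = ((- T $$ (j, j)) \<cdot>\<^sub>v col W j) $ k"
        using less.prems k W T unfolding AW by (simp add: scalar_prod_def)
    qed (use A W in simp)
    finally have eig: "A *\<^sub>v col W j = (- T $$ (j, j)) \<cdot>\<^sub>v col W j" .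
    have "T $$ (j, j) \<in> set es"
      using less.prems T by (auto simp: dg[symmetric] diag_mat_def)
    then have "poly (char_poly B) (T $$ (j, j)) = 0"
      unfolding cp poly_prod_list by (auto simp: prod_list_zero_iff)
    then have "eigenvalue B (T $$ (j, j))"
      using eigenvalue_root_char_poly[OF B] by simp
    from disj[OF this] show ?case
      using eig less.prems A W unfolding eigenvalue_def eigenvector_def
      by (metis carrier_matD(1) carrier_vecI dim_col)
  qed
  then have "W = 0\<^sub>m n n" 
    using W by (intro eq_matI) (auto simp: vec_eq_iff)
  then have "W * Q = 0\<^sub>m n n" using Q by simp
  then show ?thesis using Z P Q PQ by (simp add: W_def assoc_mult_mat[of _ n n _ n _ n])
qed

text \<open>Two evaluations of the determinant of one block matrix over the polynomial ring, with
  the scalar block \<open>X\<close> standing for x times the identity. Since \<open>X\<close>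
  commutes with everything, the block formula gives one characteristic polynomial; clearing the
  lower left block with the unimodular \<open>?E\<close> gives the other.\<close>

lemma char_poly_mult_commute:
  fixes A B :: "'a :: field mat"
  assumes A: "A \<in> carrier_mat n n" and B: "B \<in> carrier_mat n n"
  shows "char_poly (A * B) = char_poly (B * A)"
proof -
  define c :: "'a mat \<Rightarrow> 'a poly mat" where "c = map_mat (\<lambda>a. [:a:])"
  define X where "X = [:0, 1 :: 'a:] \<cdot>\<^sub>m 1\<^sub>m n"
  have cA: "c A \<in> carrier_mat n n" and cB: "c B \<in> carrier_mat n n" and X: "X \<in> carrier_mat n n"
    using A B by (auto simp: c_def X_def)
  have cm: "c (M * N) = c M * c N" if "M \<in> carrier_mat n n" "N \<in> carrier_mat n n" for M N
    unfolding c_def using map_poly_mult(1)[OF that] .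
  have cp: "char_poly (M * N) = det (X - c M * c N)"
    if "M \<in> carrier_mat n n" "N \<in> carrier_mat n n" for M N
  proof -
    have "char_poly_matrix (M * N) = X - c (M * N)"
      using that by (intro eq_matI) (auto simp: char_poly_matrix_def c_def X_def)
    then show ?thesis using cm[OF that] by (simp add: char_poly_def)
  qed
  let ?K = "four_block_mat (1\<^sub>m n) (c A) (c B) X"
  let ?E = "four_block_mat (1\<^sub>m n) (0\<^sub>m n n) (- c B) (1\<^sub>m n)"
  have comm: "c B * X = X * c B"
    using cB by (simp add: X_def mult_smult_distrib[of _ n n _ n] mult_smult_assoc_mat[of _ n n _ n])
  have "det ?K = det (1\<^sub>m n * X - c A * c B)"
    by (rule det_four_block_mat[OF _ cA cB X comm]) simp
  then have 1: "det ?K = char_poly (A * B)" using X cp[OF A B] by simp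
  have EK: "?E * ?K = four_block_mat (1\<^sub>m n) (c A) (0\<^sub>m n n) (X - c B * c A)"
    using cA cB X
    by (subst mult_four_block_mat[of _ n n _ n _ n _ _ n _ n])
       (auto simp: left_add_zero_mat right_add_zero_mat
          intro!: cong_four_block_mat eq_matI)
  have "det (?E * ?K) = det (1\<^sub>m n :: 'a poly mat) * det (X - c B * c A)"
    unfolding EK by (rule det_four_block_mat_lower_left_zero) (use cA cB X in auto)
  moreover have "det (?E * ?K) = det ?E * det ?K"
    using cA cB X by (intro det_mult[of _ "n + n"] four_block_carrier_mat) auto
  moreover have "det ?E = 1"
    using cB by (subst det_four_block_mat_upper_right_zero[of _ n _ n]) auto
  ultimately show ?thesis using 1 cp[OF B A] by simp
qed

text \<open>Over the complex numbers the polynomial splits, and a root \<open>a\<close> with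
  eigenvector \<open>v\<close> satisfies
  \<open>a * (v \<bullet>c v) = cnj a * (v \<bullet>c v)\<close>, so it is real. The factorization
  then descends to the reals because the coefficient embedding is injective.\<close>

lemma symmetric_char_poly_splits:
  fixes S :: "real mat"
  assumes S: "S \<in> carrier_mat n n" and sym: "S\<^sup>T = S"
  shows "\<exists>es. length es = n \<and> sorted_wrt (\<ge>) es \<and> char_poly S = (\<Prod>e\<leftarrow>es. [:- e, 1:])"
proof -
  interpret of_real_poly_hom: map_poly_inj_idom_hom complex_of_real ..
  let ?S = "complex_mat S"
  have cS: "?S \<in> carrier_mat n n" using S by simp
  obtain as where cp: "char_poly ?S = (\<Prod>a\<leftarrow>as. [:- a, 1:])" and len: "length as = n"
    using char_poly_factorized[OF cS] by blast
  let ?es = "rev (sort (map Re as))"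
  have "Im a = 0" if "a \<in> set as" for a
  proof -
    have "poly (char_poly ?S) a = 0"
      using that unfolding cp poly_prod_list by (auto simp: prod_list_zero_iff)
    then obtain v where v: "v \<in> carrier_vec n" "v \<noteq> 0\<^sub>v n" and Sv: "?S *\<^sub>v v = a \<cdot>\<^sub>v v"
      using eigenvalue_root_char_poly[OF cS] cS unfolding eigenvalue_def eigenvector_def by auto
    have Sc: "conjugate (?S *\<^sub>v v) = ?S *\<^sub>v conjugate v"
      using S v by (intro eq_vecI) (auto simp: scalar_prod_def)
    have "a * (v \<bullet>c v) = (?S *\<^sub>v v) \<bullet>c v" using v by (simp add: Sv)
    also have "\<dots> = v \<bullet> (?S\<^sup>T *\<^sub>v conjugate v)"
      using transpose_vec_mult_scalar[of "?S\<^sup>T" n n "conjugate v" v] v cS by simp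
    also have "?S\<^sup>T = ?S" using sym S by (metis map_mat_transpose)
    also have "v \<bullet> (?S *\<^sub>v conjugate v) = v \<bullet>c (?S *\<^sub>v v)" by (simp add: Sc)
    also have "\<dots> = cnj a * (v \<bullet>c v)" using v by (simp add: Sv conjugate_smult_vec)
    finally have "a = cnj a" using v by simp
    then show ?thesis by (simp add: complex_eq_iff)
  qed
  then have "map (\<lambda>a. [:- a, 1:]) as =
      map (map_poly complex_of_real) (map (\<lambda>e. [:- e, 1:]) (map Re as))"
    by (auto simp: complex_eq_iff)
  then have "char_poly ?S = map_poly complex_of_real (\<Prod>e\<leftarrow>map Re as. [:- e, 1:])"
    unfolding cp of_real_poly_hom.hom_prod_list by (simp only:)
  moreover have "char_poly ?S = map_poly complex_of_real (char_poly S)"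
    by (rule of_real_hom.char_poly_hom[OF S])
  ultimately have "char_poly S = (\<Prod>e\<leftarrow>map Re as. [:- e, 1:])"
    by (simp only: of_real_poly_hom.eq_iff)
  also have "\<dots> = (\<Prod>e\<leftarrow>?es. [:- e, 1:])"
    by (simp only: prod_mset_prod_list[symmetric] mset_map mset_rev mset_sort)
  finally show ?thesis
    using len by (intro exI[of _ ?es]) (simp add: sorted_wrt_rev)
qed

section \<open>The spectral theorem for real symmetric matrices\<close>

text \<open>The reflection that swaps \<open>v\<close> and the first unit vector. It is symmetric
  and its own inverse, so conjugation by it is both a similarity and a congruence, which is what
  deflating an eigenvector requires. If \<open>v $ 0 = 1\<close>, then \<open>v\<close> is already
  the first unit vector and the identity serves.\<close>

lemma householder_reflection:
  fixes v :: "real vec"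
  assumes v: "v \<in> carrier_vec n" and unit: "v \<bullet> v = 1" and n: "0 < n"
  shows "\<exists>H \<in> carrier_mat n n. H\<^sup>T = H \<and> H * H = 1\<^sub>m n \<and> col H 0 = v"
proof (cases "v $ 0 = 1")
  case True
  have "(\<Sum>i\<in>{0..<n} - {0}. v $ i * v $ i) = 0"
    using unit v n True by (simp add: scalar_prod_def sum.remove[of _ 0])
  then have "v $ i = 0" if "i < n" "i \<noteq> 0" for i
    using that by (subst (asm) sum_nonneg_eq_0_iff) auto
  then have "v = unit_vec n 0"
    using v True n by (intro eq_vecI) auto
  then show ?thesis using n by (intro bexI[of _ "1\<^sub>m n"]) auto
next
  case False
  \<comment> \<open>With \<open>w\<close> the difference of \<open>v\<close> and the first unit
    vector, its squared length is \<open>2 - 2 * v $ 0\<close>, so \<open>c\<close> is the usual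
    Householder coefficient 2 over that length.\<close>
  define c where "c = 1 / (1 - v $ 0)"
  define w where "w i = v $ i - (if i = 0 then 1 else 0)" for i
  define H where "H = mat n n (\<lambda>(i, j). (if i = j then 1 else 0) - c * w i * w j)"
  have H: "H \<in> carrier_mat n n" by (simp add: H_def)
  have cw: "c * w 0 = - 1" using False by (simp add: c_def w_def field_simps)
  have "(\<Sum>k = 0..<n. w k * w k) = (\<Sum>k = 0..<n. v $ k * v $ k + (if k = 0 then 1 - 2 * v $ 0 else 0))"
    by (intro sum.cong) (auto simp: w_def algebra_simps)
  also have "\<dots> = 2 - 2 * v $ 0"
    using unit v n by (simp add: sum.distrib scalar_prod_def)
  finally have "c * (\<Sum>k = 0..<n. w k * w k) = 2"
    using False by (simp add: c_def field_simps)
  then have ww: "c * c * w i * w j * (\<Sum>k = 0..<n. w k * w k) = 2 * c * w i * w j" for i j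
  proof -
    have "c * c * w i * w j * (\<Sum>k = 0..<n. w k * w k) = (c * (\<Sum>k = 0..<n. w k * w k)) * c * w i * w j"
      by (simp only: ac_simps)
    then show ?thesis using \<open>c * _ = 2\<close> by simp
  qed
  have HH: "H * H = 1\<^sub>m n"
  proof (rule eq_matI)
    fix i j assume "i < dim_row (1\<^sub>m n :: real mat)" "j < dim_col (1\<^sub>m n :: real mat)"
    then have ij: "i < n" "j < n" by auto
    have "(H * H) $$ (i, j) = (\<Sum>k = 0..<n. H $$ (i, k) * H $$ (k, j))"
      using ij H by (simp add: scalar_prod_def)
    also have "\<dots> = (\<Sum>k = 0..<n. (if k = i then (if i = j then 1 else 0) - c * w i * w j else 0)
        - (if k = j then c * w i * w j else 0) + c * c * w i * w j * (w k * w k))"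
      using ij by (intro sum.cong) (auto simp: H_def algebra_simps)
    also have "\<dots> = (if i = j then 1 else 0) - c * w i * w j - c * w i * w j
        + c * c * w i * w j * (\<Sum>k = 0..<n. w k * w k)"
      using ij by (simp add: sum.distrib sum_subtractf sum_distrib_left)
    also have "\<dots> = (if i = j then 1 else 0)" unfolding ww by simp
    finally show "(H * H) $$ (i, j) = 1\<^sub>m n $$ (i, j)" using ij by simp
  qed (use H in auto)
  have "col H 0 = v"
  proof (rule eq_vecI)
    fix i assume "i < dim_vec v"
    then have i: "i < n" using v by simp
    have "c * w i * w 0 = - w i" using cw by (metis mult.assoc mult.commute mult_minus1)
    then show "col H 0 $ i = v $ i" using i n by (simp add: H_def w_def)
  qed (use H v in auto)
  moreover have "H\<^sup>T = H" by (auto simp: H_def intro!: eq_matI)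
  ultimately show ?thesis using H HH by blast
qed

text \<open>Glue for the induction below: an orthogonal diagonalization of the deflated block
  extends by one dimension.\<close>

lemma conj_four_block_one:
  fixes U D :: "'a :: comm_ring_1 mat"
  assumes U: "U \<in> carrier_mat n n" and D: "D \<in> carrier_mat n n" and a: "a \<in> carrier_mat 1 1"
  defines "F \<equiv> four_block_mat (1\<^sub>m 1) (0\<^sub>m 1 n) (0\<^sub>m n 1) U"
  shows "F * four_block_mat a (0\<^sub>m 1 n) (0\<^sub>m n 1) D * F\<^sup>T =
    four_block_mat a (0\<^sub>m 1 n) (0\<^sub>m n 1) (U * D * U\<^sup>T)"
proof -
  have FT: "F\<^sup>T = four_block_mat (1\<^sub>m 1) (0\<^sub>m 1 n) (0\<^sub>m n 1) U\<^sup>T"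
    using U by (simp add: F_def transpose_four_block_mat[of _ 1 1 _ n _ n])
  have 1: "F * four_block_mat a (0\<^sub>m 1 n) (0\<^sub>m n 1) D = four_block_mat a (0\<^sub>m 1 n) (0\<^sub>m n 1) (U * D)"
    unfolding F_def using U D a
    by (subst mult_four_block_mat[of _ 1 1 _ n _ n _ _ 1 _ n]) auto
  show ?thesis
    unfolding 1 FT using U D a
    by (subst mult_four_block_mat[of _ 1 1 _ n _ n _ _ 1 _ n]) auto
qed

text \<open>Deflation by induction on the eigenvalue list. The list is an input, so the diagonal
  carries the eigenvalues in a chosen order; the Courant-Fischer argument later supplies a
  nonincreasing one.\<close>

theorem symmetric_spectral_decomposition:
  fixes S :: "real mat"
  assumes "S \<in> carrier_mat n n" and "S\<^sup>T = S" and "char_poly S = (\<Prod>e\<leftarrow>es. [:- e, 1:])"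
    and "length es = n"
  shows "\<exists>U \<in> carrier_mat n n. U\<^sup>T * U = 1\<^sub>m n \<and> S = U * mat_diag n ((!) es) * U\<^sup>T"
  using assms
proof (induction es arbitrary: n S)
  case Nil
  then show ?case by (intro bexI[of _ "1\<^sub>m 0"]) (auto intro!: eq_matI)
next
  case (Cons e es m S)
  define n where "n = length es"
  have m: "m = Suc n" using Cons.prems(4) by (simp add: n_def)
  have S: "S \<in> carrier_mat m m" and sym: "S\<^sup>T = S" using Cons.prems by auto
  have "poly (char_poly S) e = 0" by (simp add: Cons.prems(3))
  then obtain x where x: "x \<in> carrier_vec m" "x \<noteq> 0\<^sub>v m" and Sx: "S *\<^sub>v x = e \<cdot>\<^sub>v x"
    using eigenvalue_root_char_poly[OF S] S unfolding eigenvalue_def eigenvector_def by auto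
  have xx: "0 < x \<bullet> x"
    using conjugate_square_greater_0_vec[OF x(1)] x by (simp add: conjugate_vec_def)
  define v where "v = (1 / sqrt (x \<bullet> x)) \<cdot>\<^sub>v x"
  have v: "v \<in> carrier_vec m" using x by (simp add: v_def)
  have vv: "v \<bullet> v = 1" using xx x(1) by (simp add: v_def)
  have Sv: "S *\<^sub>v v = e \<cdot>\<^sub>v v"
    using S x Sx by (simp add: v_def mult_mat_vec smult_smult_assoc mult.commute)
  obtain H where H: "H \<in> carrier_mat m m" and HT: "H\<^sup>T = H" and HH: "H * H = 1\<^sub>m m" and col: "col H 0 = v"
    using householder_reflection[OF v vv] m by auto
  define S1 where "S1 = H * S * H"
  have S1: "S1 \<in> carrier_mat m m" using H S by (simp add: S1_def)
  have S1T: "S1\<^sup>T = S1"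
    using H S by (simp add: S1_def transpose_mult[of _ m m _ m] HT sym assoc_mult_mat[of _ m m _ m _ m])
  \<comment> \<open>Since \<open>v\<close> is the first column of \<open>H\<close> and
    \<open>H * H\<close> is the identity, \<open>H\<close> sends \<open>v\<close> back to the first
    unit vector. So the first column of \<open>S1\<close> is \<open>e\<close> times that vector, and
    symmetry clears the first row as well.\<close>
  have "col S1 0 = (H * S) *\<^sub>v v" using H S m unfolding S1_def by (subst col_mult2[of _ m m _ m]) (auto simp: col)
  also have "\<dots> = e \<cdot>\<^sub>v (H *\<^sub>v v)" using H S v by (simp add: Sv mult_mat_vec)
  also have "H *\<^sub>v v = col (H * H) 0" using H m by (subst col_mult2[of _ m m _ m]) (auto simp: col)
  finally have col0: "col S1 0 = e \<cdot>\<^sub>v unit_vec m 0" using m by (simp add: HH)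
  then have S1_col: "S1 $$ (i, 0) = (if i = 0 then e else 0)" if "i < m" for i
    using that S1 m by (metis (no_types, lifting) carrier_matD(1) carrier_matD(2) index_col index_smult_vec(1)
      index_unit_vec(1) index_unit_vec(3) mult.right_neutral mult_zero_right zero_less_Suc)
  have S1_row: "S1 $$ (0, i) = (if i = 0 then e else 0)" if "i < m" for i
    using S1_col[OF that] S1 S1T that m by (metis carrier_matD index_transpose_mat(1) zero_less_Suc)
  define S' where "S' = mat n n (\<lambda>(i, j). S1 $$ (Suc i, Suc j))"
  have S': "S' \<in> carrier_mat n n" by (simp add: S'_def)
  have S1_block: "S1 = four_block_mat (mat 1 1 (\<lambda>_. e)) (0\<^sub>m 1 n) (0\<^sub>m n 1) S'"
    using S1 S1_col S1_row by (intro eq_matI) (auto simp: m S'_def less_Suc_eq_0_disj)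
  \<comment> \<open>Similarity and the block form show that the linear factor of \<open>e\<close>
    splits off; cancelling it leaves the factorization that the induction hypothesis asks of
    \<open>S'\<close>.\<close>
  have "similar_mat_wit S1 S H H"
    using H S S1 HH by (intro similar_mat_witI[of _ _ m]) (auto simp: S1_def)
  then have "char_poly S = char_poly S1"
    using char_poly_similar similar_mat_def by metis
  also have "\<dots> = char_poly (mat 1 1 (\<lambda>_. e)) * char_poly S'"
    unfolding S1_block by (rule char_poly_four_block_zeros_col) (use S' in auto)
  also have "char_poly (mat 1 1 (\<lambda>_. e)) = [:- e, 1:]"
    by (subst char_poly_upper_triangular[of _ 1]) (auto simp: diag_mat_def)
  finally have cp: "char_poly S' = (\<Prod>e\<leftarrow>es. [:- e, 1:])"
    using Cons.prems(3) by (simp del: mult_pCons_left)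
  have "S'\<^sup>T = S'"
    using S1 S1T by (intro eq_matI) (auto simp: S'_def m, metis Suc_less_eq carrier_matD index_transpose_mat(1) m)
  with Cons.IH[OF S' _ cp] obtain U where U: "U \<in> carrier_mat n n" and UU: "U\<^sup>T * U = 1\<^sub>m n"
    and S'_eq: "S' = U * mat_diag n ((!) es) * U\<^sup>T"
    by (auto simp: n_def)
  define F where "F = four_block_mat (1\<^sub>m 1) (0\<^sub>m 1 n) (0\<^sub>m n 1) U"
  define D where "D = mat_diag m ((!) (e # es))"
  have F: "F \<in> carrier_mat m m" and D: "D \<in> carrier_mat m m" 
    using U by (auto simp: F_def D_def m)
  have "D = four_block_mat (mat 1 1 (\<lambda>_. e)) (0\<^sub>m 1 n) (0\<^sub>m n 1) (mat_diag n ((!) es))"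
    by (intro eq_matI) (auto simp: D_def m mat_diag_def nth_Cons')
  then have S1_eq: "S1 = F * D * F\<^sup>T"
    using conj_four_block_one[OF U mat_diag_dim, of "mat 1 1 (\<lambda>_. e)"]
    by (simp add: S1_block F_def S'_eq)
  have FT: "F\<^sup>T = four_block_mat (1\<^sub>m 1) (0\<^sub>m 1 n) (0\<^sub>m n 1) U\<^sup>T"
    using U by (simp add: F_def transpose_four_block_mat[of _ 1 1 _ n _ n])
  have FF: "F\<^sup>T * F = 1\<^sub>m m"
    unfolding FT unfolding F_def using U UU m
    by (subst mult_four_block_mat[of _ 1 1 _ n _ n _ _ 1 _ n]) auto
  have "H * S1 * H = (H * H) * S * (H * H)"
    using H S by (simp add: S1_def assoc_mult_mat[of _ m m _ m _ m])
  then have "S = H * S1 * H" using H S by (simp add: HH)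
  then have "S = (H * F) * D * (H * F)\<^sup>T"
    using H F D by (simp add: S1_eq transpose_mult[of _ m m _ m] HT assoc_mult_mat[of _ m m _ m _ m])
  moreover have "(H * F)\<^sup>T * (H * F) = F\<^sup>T * (H * H) * F"
    using H F by (simp add: transpose_mult[of _ m m _ m] HT assoc_mult_mat[of _ m m _ m _ m])
  moreover have "\<dots> = 1\<^sub>m m" using F by (simp add: HH FF)
  ultimately show ?case using H F by (intro bexI[of _ "H * F"]) (auto simp: D_def)
qed

section \<open>Monotonicity of eigenvalues\<close>

lemma sorted_eigenvalues_eq:
  assumes "char_poly S = (\<Prod>e\<leftarrow>es. [:- e, 1:])" and "sorted_wrt (\<ge>) es"
  shows "sorted_eigenvalues S = es"
proof -
  have "proots (\<Prod>e\<leftarrow>es. [:- e, 1:]) = mset es"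
  proof (induction es)
    case (Cons e es)
    have "(\<Prod>e\<leftarrow>es. [:- e, 1:]) \<noteq> 0" by (auto simp: prod_list_zero_iff)
    with Cons show ?case by (simp add: proots_mult proots_linear_factor del: mult_pCons_left)
  qed simp
  moreover have "sort es = rev es"
    using assms(2) by (intro properties_for_sort) (auto simp: sorted_wrt_rev)
  ultimately show ?thesis
    by (simp add: sorted_eigenvalues_def assms(1))
qed

lemma orthogonal_dot:
  fixes U :: "real mat"
  assumes U: "U \<in> carrier_mat n n" and UU: "U\<^sup>T * U = 1\<^sub>m n"
    and a: "a \<in> carrier_vec n" and b: "b \<in> carrier_vec n"
  shows "(U *\<^sub>v a) \<bullet> (U *\<^sub>v b) = a \<bullet> b"
proof -
  have "(U *\<^sub>v a) \<bullet> (U *\<^sub>v b) = (U\<^sup>T *\<^sub>v (U *\<^sub>v a)) \<bullet> b"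
    using transpose_vec_mult_scalar[of U n n b "U *\<^sub>v a"] U a b by simp
  also have "U\<^sup>T *\<^sub>v (U *\<^sub>v a) = (U\<^sup>T * U) *\<^sub>v a" using U a by simp
  finally show ?thesis using a by (simp add: UU)
qed

lemma quadratic_form_diagonalized:
  fixes U :: "real mat"
  assumes U: "U \<in> carrier_mat n n" and UU: "U\<^sup>T * U = 1\<^sub>m n" and a: "a \<in> carrier_vec n"
  shows "(U *\<^sub>v a) \<bullet> ((U * mat_diag n d * U\<^sup>T) *\<^sub>v (U *\<^sub>v a)) = (\<Sum>i = 0..<n. d i * (a $ i)\<^sup>2)"
proof -
  have Da: "mat_diag n d *\<^sub>v a \<in> carrier_vec n" using a by (metis mat_diag_dim mult_mat_vec_carrier)
  have "(U * mat_diag n d * U\<^sup>T) *\<^sub>v (U *\<^sub>v a) = U *\<^sub>v (mat_diag n d *\<^sub>v ((U\<^sup>T * U) *\<^sub>v a))"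
    using U a by (simp add: assoc_mult_mat_vec[of _ n n _ n])
  also have "\<dots> = U *\<^sub>v (mat_diag n d *\<^sub>v a)" using a by (simp add: UU)
  finally have "(U *\<^sub>v a) \<bullet> ((U * mat_diag n d * U\<^sup>T) *\<^sub>v (U *\<^sub>v a)) = a \<bullet> (mat_diag n d *\<^sub>v a)"
    using orthogonal_dot[OF U UU a Da] by simp
  also have "mat_diag n d *\<^sub>v a = vec n (\<lambda>i. d i * a $ i)"
    using a by (intro eq_vecI) (auto simp: mat_diag_def scalar_prod_def if_distrib if_distribR cong: if_cong)
  finally show ?thesis
    using a by (simp add: scalar_prod_def power2_eq_square mult.left_commute)
qed

text \<open>A zero row appended to the \<open>k\<close> equations makes the system square. The
  transpose then kills the last unit vector, so the determinant is zero and a nonzero kernel vector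
  exists.\<close>

lemma homogeneous_system_nonzero_solution:
  fixes K :: "nat \<Rightarrow> nat \<Rightarrow> 'a :: field"
  shows "\<exists>a \<in> carrier_vec (Suc k). a \<noteq> 0\<^sub>v (Suc k) \<and> (\<forall>i<k. (\<Sum>j = 0..k. K i j * a $ j) = 0)"
proof -
  define N where "N = mat (Suc k) (Suc k) (\<lambda>(i, j). if i < k then K i j else 0)"
  have N: "N \<in> carrier_mat (Suc k) (Suc k)" by (simp add: N_def)
  have "N\<^sup>T *\<^sub>v unit_vec (Suc k) k = 0\<^sub>v (Suc k)"
    by (intro eq_vecI) (auto simp: N_def)
  moreover have "unit_vec (Suc k) k \<noteq> (0\<^sub>v (Suc k) :: 'a vec)"
    by (metis index_unit_vec(1) index_zero_vec(1) lessI zero_neq_one)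
  ultimately have "det N\<^sup>T = 0"
    using N by (subst det_0_iff_vec_prod_zero[of _ "Suc k"]) (auto intro!: exI[of _ "unit_vec (Suc k) k"])
  then have "det N = 0" using det_transpose[OF N] by simp
  then obtain a where a: "a \<in> carrier_vec (Suc k)" "a \<noteq> 0\<^sub>v (Suc k)" "N *\<^sub>v a = 0\<^sub>v (Suc k)"
    using det_0_iff_vec_prod_zero[OF N] by auto
  have "(\<Sum>j = 0..k. K i j * a $ j) = 0" if "i < k" for i
  proof -
    have "(N *\<^sub>v a) $ i = (\<Sum>j = 0..<Suc k. K i j * a $ j)"
      using that a(1) by (auto simp: N_def scalar_prod_def intro!: sum.cong)
    then show ?thesis using that by (simp add: a(3) atLeastLessThanSuc_atLeastAtMost)
  qed
  then show ?thesis using a by blast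
qed

text \<open>Courant--Fischer in dimension-count form: the span of the top \<open>k + 1\<close> eigenvectors of
  \<open>S\<^sub>1\<close> meets the span of all but the top \<open>k\<close> eigenvectors of \<open>S\<^sub>2\<close>.\<close>

theorem sorted_eigenvalues_mono:
  fixes S\<^sub>1 S\<^sub>2 :: "real mat"
  assumes S1: "S\<^sub>1 \<in> carrier_mat n n" "S\<^sub>1\<^sup>T = S\<^sub>1" and S2: "S\<^sub>2 \<in> carrier_mat n n" "S\<^sub>2\<^sup>T = S\<^sub>2"
    and le: "psd n (S\<^sub>2 - S\<^sub>1)" and k: "k < n"
  shows "sorted_eigenvalues S\<^sub>1 ! k \<le> sorted_eigenvalues S\<^sub>2 ! k"
proof -
  obtain d e where d: "length d = n" "sorted_wrt (\<ge>) d" "char_poly S\<^sub>1 = (\<Prod>e\<leftarrow>d. [:- e, 1:])"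
    and e: "length e = n" "sorted_wrt (\<ge>) e" "char_poly S\<^sub>2 = (\<Prod>e\<leftarrow>e. [:- e, 1:])"
    using symmetric_char_poly_splits[OF S1] symmetric_char_poly_splits[OF S2] by blast
  obtain U where U: "U \<in> carrier_mat n n" and UU: "U\<^sup>T * U = 1\<^sub>m n"
    and S1_eq: "S\<^sub>1 = U * mat_diag n ((!) d) * U\<^sup>T"
    using symmetric_spectral_decomposition[OF S1 d(3,1)] by blast
  obtain V where V: "V \<in> carrier_mat n n" and VV: "V\<^sup>T * V = 1\<^sub>m n"
    and S2_eq: "S\<^sub>2 = V * mat_diag n ((!) e) * V\<^sup>T"
    using symmetric_spectral_decomposition[OF S2 e(3,1)] by blast
  \<comment> \<open>\<open>W\<close> converts coordinates in the eigenbasis \<open>U\<close> into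
    coordinates in \<open>V\<close>. Below, \<open>a\<close> and \<open>b\<close> describe the same
    vector: \<open>a\<close> is supported on indices up to \<open>k\<close>, and the
    \<open>k\<close> equations solved by \<open>c\<close> remove the entries of \<open>b\<close>
    below \<open>k\<close>.\<close>
  define W where "W = V\<^sup>T * U"
  have W: "W \<in> carrier_mat n n" using U V by (simp add: W_def)
  obtain c where c: "c \<in> carrier_vec (Suc k)" "c \<noteq> 0\<^sub>v (Suc k)"
    and Kc: "\<And>i. i < k \<Longrightarrow> (\<Sum>j = 0..k. W $$ (i, j) * c $ j) = 0"
    using homogeneous_system_nonzero_solution[of k "\<lambda>i j. W $$ (i, j)"] by blast
  define a where "a = vec n (\<lambda>j. if j \<le> k then c $ j else 0)"
  define b where "b = W *\<^sub>v a"
  have a: "a \<in> carrier_vec n" and b: "b \<in> carrier_vec n"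
    using W by (auto simp: a_def b_def)
  have b0: "b $ i = 0" if "i < k" for i
  proof -
    have "b $ i = (\<Sum>j = 0..<n. if j \<in> {0..k} then W $$ (i, j) * c $ j else 0)"
      using that k W unfolding b_def
      by (auto simp: scalar_prod_def a_def intro!: sum.cong)
    also have "\<dots> = (\<Sum>j \<in> {0..<n} \<inter> {0..k}. W $$ (i, j) * c $ j)"
      by (subst sum.inter_restrict) auto
    also have "{0..<n} \<inter> {0..k} = {0..k}" using k by auto
    finally show ?thesis using Kc[OF that] by simp
  qed
  have "V * V\<^sup>T = 1\<^sub>m n"
    using mat_mult_left_right_inverse[OF _ V VV] V by simp
  then have VW: "V * W = U"
    using assoc_mult_mat[of V n n "V\<^sup>T" n U n] U V by (simp add: W_def)
  have Vb: "V *\<^sub>v b = U *\<^sub>v a"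
    unfolding b_def assoc_mult_mat_vec[OF V W a, symmetric] VW ..
  have norm: "(\<Sum>i = 0..<n. (a $ i)\<^sup>2) = (\<Sum>i = 0..<n. (b $ i)\<^sup>2)"
    using orthogonal_dot[OF U UU a a] orthogonal_dot[OF V VV b b] a b
    by (simp add: Vb scalar_prod_def power2_eq_square)
  obtain j where j: "j < Suc k" "c $ j \<noteq> 0"
    using c by (metis carrier_vecD eq_vecI index_zero_vec)
  then have "0 < (a $ j)\<^sup>2" "j \<in> {0..<n}" using k by (auto simp: a_def)
  then have pos: "0 < (\<Sum>i = 0..<n. (a $ i)\<^sup>2)"
    by (intro sum_pos2) auto
  \<comment> \<open>Both supports meet the sorted spectra at index \<open>k\<close>: where
    \<open>a\<close> may be nonzero the entries of \<open>d\<close> are at least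
    \<open>d ! k\<close>, and where \<open>b\<close> may be nonzero those of \<open>e\<close> are at
    most \<open>e ! k\<close>. The two squared norms agree and are positive, so they cancel at the
    end.\<close>
  have "d ! k * (\<Sum>i = 0..<n. (a $ i)\<^sup>2) \<le> (\<Sum>i = 0..<n. d ! i * (a $ i)\<^sup>2)"
    unfolding sum_distrib_left
  proof (rule sum_mono)
    fix i assume i: "i \<in> {0..<n}"
    show "d ! k * (a $ i)\<^sup>2 \<le> d ! i * (a $ i)\<^sup>2"
    proof (cases "i \<le> k")
      case True
      then have "d ! k \<le> d ! i" using d(1,2) k sorted_wrt_nth_less[OF d(2), of i k] by (cases "i = k") auto
      then show ?thesis by (rule mult_right_mono) simp
    qed (use i in \<open>simp add: a_def\<close>)
  qed
  also have "\<dots> = (U *\<^sub>v a) \<bullet> (S\<^sub>1 *\<^sub>v (U *\<^sub>v a))"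
    unfolding S1_eq by (rule quadratic_form_diagonalized[OF U UU a, symmetric])
  also have "\<dots> \<le> (U *\<^sub>v a) \<bullet> (S\<^sub>2 *\<^sub>v (U *\<^sub>v a))"
  proof -
    have v: "U *\<^sub>v a \<in> carrier_vec n" using U a by simp
    then have "0 \<le> (U *\<^sub>v a) \<bullet> ((S\<^sub>2 - S\<^sub>1) *\<^sub>v (U *\<^sub>v a))" using le by (simp add: psd_def)
    also have "(S\<^sub>2 - S\<^sub>1) *\<^sub>v (U *\<^sub>v a) = S\<^sub>2 *\<^sub>v (U *\<^sub>v a) - S\<^sub>1 *\<^sub>v (U *\<^sub>v a)"
      using S1 S2 v by (intro minus_mult_distrib_mat_vec) auto
    finally show ?thesis using S1 S2 v by (simp add: scalar_prod_minus_distrib[of _ n])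
  qed
  also have "\<dots> = (\<Sum>i = 0..<n. e ! i * (b $ i)\<^sup>2)"
    unfolding S2_eq Vb[symmetric] by (rule quadratic_form_diagonalized[OF V VV b])
  also have "\<dots> \<le> e ! k * (\<Sum>i = 0..<n. (b $ i)\<^sup>2)"
    unfolding sum_distrib_left
  proof (rule sum_mono)
    fix i assume i: "i \<in> {0..<n}"
    show "e ! i * (b $ i)\<^sup>2 \<le> e ! k * (b $ i)\<^sup>2"
    proof (cases "k \<le> i")
      case True
      then have "e ! i \<le> e ! k" using e(1,2) i sorted_wrt_nth_less[OF e(2), of k i] by (cases "i = k") auto
      then show ?thesis by (rule mult_right_mono) simp
    qed (simp add: b0)
  qed
  finally have "d ! k \<le> e ! k" using pos by (simp add: norm)
  then show ?thesis
    using sorted_eigenvalues_eq[OF d(3,2)] sorted_eigenvalues_eq[OF e(3,2)] by simp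
qed

section \<open>Factoring the positive semidefinite matrix and congruence by its factor\<close>

text \<open>The factor is \<open>U\<close> with its columns scaled by square roots of the
  eigenvalues. These are nonnegative, being the values of the quadratic form at the columns of
  \<open>U\<close>.\<close>

lemma psd_factorization:
  assumes P: "psd n P"
  shows "\<exists>R \<in> carrier_mat n n. P = R * R\<^sup>T"
proof -
  have Pc: "P \<in> carrier_mat n n" and PT: "P\<^sup>T = P" using P by (auto simp: psd_def)
  obtain d where d: "length d = n" "char_poly P = (\<Prod>e\<leftarrow>d. [:- e, 1:])"
    using symmetric_char_poly_splits[OF Pc PT] by blast
  obtain U where U: "U \<in> carrier_mat n n" and UU: "U\<^sup>T * U = 1\<^sub>m n"
    and P_eq: "P = U * mat_diag n ((!) d) * U\<^sup>T"
    using symmetric_spectral_decomposition[OF Pc PT d(2,1)] by blast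
  have d_nonneg: "0 \<le> d ! i" if "i < n" for i
  proof -
    have "0 \<le> (U *\<^sub>v unit_vec n i) \<bullet> (P *\<^sub>v (U *\<^sub>v unit_vec n i))"
      using P U by (simp add: psd_def)
    also have "\<dots> = (\<Sum>j = 0..<n. d ! j * (unit_vec n i $ j)\<^sup>2)"
      unfolding P_eq by (rule quadratic_form_diagonalized[OF U UU]) simp
    also have "\<dots> = (\<Sum>j = 0..<n. if j = i then d ! i else 0)"
      using that by (intro sum.cong) auto
    finally show ?thesis using that by simp
  qed
  define E where "E = mat_diag n (\<lambda>i. sqrt (d ! i))"
  have E: "E \<in> carrier_mat n n" by (simp add: E_def)
  have ET: "E\<^sup>T = E" by (auto simp: E_def mat_diag_def intro!: eq_matI)
  have "E * E = mat_diag n ((!) d)"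
    unfolding E_def mat_diag_diag using d_nonneg by (auto simp: mat_diag_def intro!: eq_matI)
  then have "P = (U * E) * (U * E)\<^sup>T"
    using U E by (simp add: P_eq transpose_mult[of _ n n _ n] ET assoc_mult_mat[of _ n n _ n _ n])
      (simp add: assoc_mult_mat[of _ n n _ n _ n, symmetric])
  then show ?thesis using U E by (intro bexI[of _ "U * E"]) auto
qed

lemma congruence_symmetric:
  fixes Q R :: "real mat"
  assumes "R \<in> carrier_mat n n" and "Q \<in> carrier_mat n n" and "Q\<^sup>T = Q"
  shows "(R\<^sup>T * Q * R)\<^sup>T = R\<^sup>T * Q * R"
  using assms by (simp add: transpose_mult[of _ n n _ n] assoc_mult_mat[of _ n n _ n _ n])

lemma psd_congruence:
  assumes R: "R \<in> carrier_mat n n" and Q: "psd n Q"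
  shows "psd n (R\<^sup>T * Q * R)"
  unfolding psd_def
proof (intro conjI ballI)
  have Qc: "Q \<in> carrier_mat n n" "Q\<^sup>T = Q" using Q by (auto simp: psd_def)
  then show "(R\<^sup>T * Q * R)\<^sup>T = R\<^sup>T * Q * R" by (rule congruence_symmetric[OF R])
  show "R\<^sup>T * Q * R \<in> carrier_mat n n" using R Qc(1) by auto
  fix v :: "real vec" assume v: "v \<in> carrier_vec n"
  have "v \<bullet> ((R\<^sup>T * Q * R) *\<^sub>v v) = v \<bullet> (R\<^sup>T *\<^sub>v (Q *\<^sub>v (R *\<^sub>v v)))"
    using R Qc(1) v by (simp add: assoc_mult_mat_vec[of _ n n _ n])
  also have "\<dots> = (R *\<^sub>v v) \<bullet> (Q *\<^sub>v (R *\<^sub>v v))"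
    using transpose_vec_mult_scalar[of "R\<^sup>T" n n "Q *\<^sub>v (R *\<^sub>v v)" v] R Qc(1) v by simp
  finally show "0 \<le> v \<bullet> ((R\<^sup>T * Q * R) *\<^sub>v v)"
    using Q R v by (simp add: psd_def)
qed

lemma char_poly_psd_mult:
  assumes R: "R \<in> carrier_mat n n" and Q: "(Q :: real mat) \<in> carrier_mat n n"
  shows "char_poly (R * R\<^sup>T * Q) = char_poly (R\<^sup>T * Q * R)"
  using char_poly_mult_commute[of R n "R\<^sup>T * Q"] R Q by (simp add: assoc_mult_mat[of _ n n _ n _ n])

lemma sorted_eigenvalues_psd_mult_mono:
  assumes P: "psd n P" and Q1: "Q\<^sub>1 \<in> carrier_mat n n" "Q\<^sub>1\<^sup>T = Q\<^sub>1"
    and Q2: "Q\<^sub>2 \<in> carrier_mat n n" "Q\<^sub>2\<^sup>T = Q\<^sub>2"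
    and le: "psd n (Q\<^sub>2 - Q\<^sub>1)" and k: "k < n"
  shows "sorted_eigenvalues (P * Q\<^sub>1) ! k \<le> sorted_eigenvalues (P * Q\<^sub>2) ! k"
proof -
  obtain R where R: "R \<in> carrier_mat n n" and PR: "P = R * R\<^sup>T"
    using psd_factorization[OF P] by blast
  have diff: "R\<^sup>T * Q\<^sub>2 * R - R\<^sup>T * Q\<^sub>1 * R = R\<^sup>T * (Q\<^sub>2 - Q\<^sub>1) * R"
    using R Q1 Q2 by (simp add: mult_minus_distrib_mat[of _ n n _ n] minus_mult_distrib_mat[of _ n n _ _ n])
  have "psd n (R\<^sup>T * Q\<^sub>2 * R - R\<^sup>T * Q\<^sub>1 * R)"
    unfolding diff by (rule psd_congruence[OF R le])
  then have "sorted_eigenvalues (R\<^sup>T * Q\<^sub>1 * R) ! k \<le> sorted_eigenvalues (R\<^sup>T * Q\<^sub>2 * R) ! k"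
    using R Q1(1) Q2(1) k
    by (intro sorted_eigenvalues_mono congruence_symmetric[OF R] Q1 Q2) auto
  then show ?thesis
    using char_poly_psd_mult[OF R Q1(1)] char_poly_psd_mult[OF R Q2(1)]
    by (simp add: sorted_eigenvalues_def PR)
qed

section \<open>Lyapunov equations and Gramians\<close>

lemma det_nonzero_inverse:
  fixes N :: "'a :: field mat"
  assumes N: "N \<in> carrier_mat n n" and det: "det N \<noteq> 0"
  shows "\<exists>E \<in> carrier_mat n n. E * N = 1\<^sub>m n \<and> N * E = 1\<^sub>m n"
  using det_non_zero_imp_unit[OF N det, of "()"]
  by (auto simp: Units_def ring_mat_def)

section \<open>Power bounds and the Stein equation\<close>

lemma pow_mat_smult:
  fixes A :: "'a :: comm_ring_1 mat"
  assumes A: "A \<in> carrier_mat n n"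
  shows "(c \<cdot>\<^sub>m A) ^\<^sub>m k = c ^ k \<cdot>\<^sub>m (A ^\<^sub>m k)"
proof (induction k)
  case (Suc k)
  have "A ^\<^sub>m k \<in> carrier_mat n n" using A by simp
  then show ?case
    using Suc A by (auto simp: mult_smult_distrib[of _ n n _ n] mult_smult_assoc_mat[of _ n n _ n]
        intro!: eq_matI)
qed (use A in auto)

text \<open>A rate \<open>r\<close> strictly between the spectral radius and 1 leaves room to
  rescale: \<open>F\<close> divided by \<open>r\<close> still has spectral radius below 1, so its
  powers are bounded entrywise by a constant, and undoing the scaling yields the decay. Dimension
  zero is separate because the spectrum is empty there.\<close>

lemma pow_mat_geometric_bound:
  fixes F :: "real mat"
  assumes F: "F \<in> carrier_mat n n"
    and ev: "\<And>z. eigenvalue (complex_mat F) z \<Longrightarrow> norm z < 1"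
  shows "\<exists>c r. 0 \<le> r \<and> r < 1 \<and> (\<forall>k. \<forall>i<n. \<forall>j<n. \<bar>(F ^\<^sub>m k) $$ (i, j)\<bar> \<le> c * r ^ k)"
proof (cases "n = 0")
  case True
  then show ?thesis by (intro exI[of _ 0]) auto
next
  case False
  let ?F = "complex_mat F"
  have cF: "?F \<in> carrier_mat n n" using F by simp
  obtain z where "eigenvalue ?F z" and \<rho>: "spectral_radius ?F = norm z"
    using spectral_radius_mem_max(1)[OF cF] False by (auto simp: spectrum_def)
  then have lt: "0 \<le> spectral_radius ?F" "spectral_radius ?F < 1" using ev by auto
  define r where "r = (spectral_radius ?F + 1) / 2"
  have r: "0 < r" "r < 1" "spectral_radius ?F < r" using lt by (auto simp: r_def)
  define G where "G = complex_of_real (1 / r) \<cdot>\<^sub>m ?F"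
  have G: "G \<in> carrier_mat n n" using cF by (simp add: G_def)
  obtain y where "eigenvalue G y" and y: "spectral_radius G = norm y"
    using spectral_radius_mem_max(1)[OF G] False by (auto simp: spectrum_def)
  then obtain v where v: "v \<in> carrier_vec n" "v \<noteq> 0\<^sub>v n" and Gv: "G *\<^sub>v v = y \<cdot>\<^sub>v v"
    using G unfolding eigenvalue_def eigenvector_def by auto
  have "?F = complex_of_real r \<cdot>\<^sub>m G"
    using r(1) by (auto simp: G_def intro!: eq_matI)
  then have "?F *\<^sub>v v = complex_of_real r \<cdot>\<^sub>v (G *\<^sub>v v)"
    using G v by (auto intro!: eq_vecI)
  also have "\<dots> = (of_real r * y) \<cdot>\<^sub>v v" by (simp add: Gv smult_smult_assoc)
  finally have "eigenvalue ?F (of_real r * y)"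
    using v cF unfolding eigenvalue_def eigenvector_def by auto
  then have "norm (of_real r * y) \<le> spectral_radius ?F"
    using spectral_radius_mem_max(2)[OF cF] False by (auto simp: spectrum_def)
  moreover have "norm (of_real r * y) = r * norm y" using r(1) by (simp add: norm_mult)
  ultimately have "r * norm y < r * 1" using r(3) by linarith
  then have "spectral_radius G < 1" using r(1) unfolding y by (simp only: mult_less_cancel_left_pos)
  then obtain c where c: "\<And>k. norm_bound (G ^\<^sub>m k) c"
    using spectral_radius_jnf_norm_bound_less_1_upper_triangular[OF G] by blast
  have "\<bar>(F ^\<^sub>m k) $$ (i, j)\<bar> \<le> c * r ^ k" if "i < n" "j < n" for k i j
  proof -
    have Fk: "?F ^\<^sub>m k = complex_mat (F ^\<^sub>m k)" by (rule of_real_hom.mat_hom_pow[OF F, symmetric])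
    have "norm ((G ^\<^sub>m k) $$ (i, j)) \<le> c"
      using c[of k] that G unfolding norm_bound_def by simp
    also have "(G ^\<^sub>m k) $$ (i, j) = of_real (1 / r) ^ k * of_real ((F ^\<^sub>m k) $$ (i, j))"
      using that F unfolding G_def pow_mat_smult[OF cF] Fk by simp
    also have "norm \<dots> = \<bar>(F ^\<^sub>m k) $$ (i, j)\<bar> / r ^ k"
      using r(1) by (simp add: norm_mult norm_power norm_divide power_one_over field_simps)
    finally show ?thesis using r(1) by (simp add: divide_le_eq)
  qed
  then show ?thesis using r by (intro exI[of _ c] exI[of _ r]) auto
qed

text \<open>Entries as finite sums, so that absolute bounds and infinite series can be handled term
  by term.\<close>

lemma mat_triple_product_index:
  fixes X T Y :: "'a :: comm_semiring_0 mat"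
  assumes "X \<in> carrier_mat n n" "T \<in> carrier_mat n n" "Y \<in> carrier_mat n n" "i < n" "j < n"
  shows "(X * T * Y) $$ (i, j) = (\<Sum>b = 0..<n. \<Sum>a = 0..<n. X $$ (i, a) * T $$ (a, b) * Y $$ (b, j))"
proof -
  have "X * T = mat n n (\<lambda>(i, b). \<Sum>a = 0..<n. X $$ (i, a) * T $$ (a, b))"
    using assms by (intro eq_matI) (auto simp: scalar_prod_def)
  then show ?thesis using assms by (simp add: scalar_prod_def sum_distrib_right)
qed

lemma quadratic_form_sum:
  fixes T :: "'a :: comm_semiring_0 mat"
  assumes "T \<in> carrier_mat n n" "v \<in> carrier_vec n"
  shows "v \<bullet> (T *\<^sub>v v) = (\<Sum>a = 0..<n. \<Sum>b = 0..<n. v $ a * (T $$ (a, b) * v $ b))"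
  using assms by (simp add: scalar_prod_def sum_distrib_left)

lemma psd_mult_transpose:
  fixes X :: "real mat"
  assumes X: "X \<in> carrier_mat n m"
  shows "psd n (X * X\<^sup>T)"
  unfolding psd_def
proof (intro conjI ballI)
  fix v :: "real vec" assume v: "v \<in> carrier_vec n"
  have "v \<bullet> ((X * X\<^sup>T) *\<^sub>v v) = v \<bullet> (X *\<^sub>v (X\<^sup>T *\<^sub>v v))"
    using X v by (simp add: assoc_mult_mat_vec[of _ n m _ n])
  also have "\<dots> = (X\<^sup>T *\<^sub>v v) \<bullet> (X\<^sup>T *\<^sub>v v)"
    using transpose_vec_mult_scalar[of X n m "X\<^sup>T *\<^sub>v v" v] X v by simp
  also have "\<dots> \<ge> 0" by (simp add: scalar_prod_def sum_nonneg)
  finally show "0 \<le> v \<bullet> ((X * X\<^sup>T) *\<^sub>v v)" .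
qed (use X in \<open>auto simp: transpose_mult[of _ n m _ n]\<close>)

text \<open>The solution is the series of the terms
  \<open>F ^\<^sub>m k * G * (F ^\<^sub>m k)\<^sup>T\<close>, taken entrywise. Its entries decay
  like \<open>(r * r) ^ k\<close>, and its quadratic form is a sum of nonnegative numbers.\<close>

lemma stein_equation_solution:
  fixes F G :: "real mat"
  assumes F: "F \<in> carrier_mat n n" and G: "psd n G"
    and ev: "\<And>z. eigenvalue (complex_mat F) z \<Longrightarrow> norm z < 1"
  shows "\<exists>P. psd n P \<and> P = F * P * F\<^sup>T + G"
proof -
  have Gc: "G \<in> carrier_mat n n" using G by (simp add: psd_def)
  obtain c r where r: "0 \<le> r" "r < 1"
    and bound: "\<And>k i j. i < n \<Longrightarrow> j < n \<Longrightarrow> \<bar>(F ^\<^sub>m k) $$ (i, j)\<bar> \<le> c * r ^ k"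
    using pow_mat_geometric_bound[OF F ev] by blast
  define T where "T k = F ^\<^sub>m k * G * (F ^\<^sub>m k)\<^sup>T" for k
  have Fk: "F ^\<^sub>m k \<in> carrier_mat n n" for k using F by simp
  have T: "T k \<in> carrier_mat n n" for k unfolding T_def using Fk[of k] Gc by auto
  have psdT: "psd n (T k)" for k
    using psd_congruence[OF _ G, of "(F ^\<^sub>m k)\<^sup>T"] Fk by (simp add: T_def)
  \<comment> \<open>The recursion of matrix powers multiplies on the right, whereas
    \<open>T_Suc\<close> needs the new factor \<open>F\<close> on the outside.\<close>
  have F_pow: "F ^\<^sub>m Suc k = F * F ^\<^sub>m k" for k
  proof (induction k)
    case (Suc k)
    have "F ^\<^sub>m Suc (Suc k) = (F * F ^\<^sub>m k) * F" using Suc by simp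
    also have "\<dots> = F * F ^\<^sub>m Suc k" using assoc_mult_mat[OF F Fk F] by simp
    finally show ?case .
  qed (use F in auto)
  have T_Suc: "T (Suc k) = F * T k * F\<^sup>T" for k
    using F Fk[of k] Gc unfolding T_def F_pow
    by (simp add: transpose_mult[of _ n n _ n] assoc_mult_mat[of _ n n _ n _ n]
        mult_carrier_mat[of _ n n _ n])
  have rr: "r * r < 1" using r mult_left_mono[of r 1 r] by linarith
  have summ: "summable (\<lambda>k. T k $$ (i, j))" if ij: "i < n" "j < n" for i j
  proof (rule summable_comparison_test')
    show "summable (\<lambda>k. (c * c * (\<Sum>b = 0..<n. \<Sum>a = 0..<n. \<bar>G $$ (a, b)\<bar>)) * (r * r) ^ k)"
      using r rr by (intro summable_mult summable_geometric) simp
    fix k :: nat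
    have c0: "0 \<le> c * r ^ k" using order_trans[OF abs_ge_zero bound[OF ij]] .
    have "T k $$ (i, j) =
        (\<Sum>b = 0..<n. \<Sum>a = 0..<n. (F ^\<^sub>m k) $$ (i, a) * G $$ (a, b) * (F ^\<^sub>m k)\<^sup>T $$ (b, j))"
      unfolding T_def using ij Fk[of k] Gc by (intro mat_triple_product_index) auto
    also have "\<bar>\<dots>\<bar> \<le> (\<Sum>b = 0..<n. \<Sum>a = 0..<n. (c * r ^ k) * \<bar>G $$ (a, b)\<bar> * (c * r ^ k))"
    proof (intro order_trans[OF sum_abs] sum_mono)
      fix a b assume "b \<in> {0..<n}" "a \<in> {0..<n}"
      then have ab: "a < n" "b < n" by auto
      then have "(F ^\<^sub>m k)\<^sup>T $$ (b, j) = (F ^\<^sub>m k) $$ (j, b)" using ij F by simp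
      then show "\<bar>(F ^\<^sub>m k) $$ (i, a) * G $$ (a, b) * (F ^\<^sub>m k)\<^sup>T $$ (b, j)\<bar>
          \<le> (c * r ^ k) * \<bar>G $$ (a, b)\<bar> * (c * r ^ k)"
        unfolding abs_mult using bound[OF ij(1) ab(1), of k] bound[OF ij(2) ab(2), of k] c0
        by (auto intro!: mult_mono)
    qed
    also have "\<dots> = (c * c * (\<Sum>b = 0..<n. \<Sum>a = 0..<n. \<bar>G $$ (a, b)\<bar>)) * (r * r) ^ k"
      by (simp add: sum_distrib_left sum_distrib_right power_mult_distrib ac_simps)
    finally show "norm (T k $$ (i, j)) \<le>
        (c * c * (\<Sum>b = 0..<n. \<Sum>a = 0..<n. \<bar>G $$ (a, b)\<bar>)) * (r * r) ^ k" by simp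
  qed
  define P where "P = mat n n (\<lambda>(i, j). \<Sum>k. T k $$ (i, j))"
  have P: "P \<in> carrier_mat n n" by (simp add: P_def)
  have sums: "(\<lambda>k. T k $$ (i, j)) sums P $$ (i, j)" if "i < n" "j < n" for i j
    using summ[OF that] that by (simp add: P_def summable_sums)
  have "P = F * P * F\<^sup>T + G"
  proof (rule eq_matI)
    fix i j assume "i < dim_row (F * P * F\<^sup>T + G)" "j < dim_col (F * P * F\<^sup>T + G)"
    then have ij: "i < n" "j < n" using Gc by auto
    \<comment> \<open>Conjugating by \<open>F\<close> shifts the series by one index; the missing
      term \<open>T 0\<close> is \<open>G\<close>.\<close>
    have "(\<lambda>k. T (Suc k) $$ (i, j)) sums (F * P * F\<^sup>T) $$ (i, j)"
      unfolding T_Suc using ij F T P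
      by (subst (1 2) mat_triple_product_index[of _ n])
        (simp_all, intro sums_sum sums_mult2 sums_mult sums, simp_all)
    then have "(\<lambda>k. T k $$ (i, j)) sums ((F * P * F\<^sup>T) $$ (i, j) + T 0 $$ (i, j))"
      by (subst (asm) sums_Suc_iff) (simp add: algebra_simps)
    moreover have "T 0 = G" using F Gc by (simp add: T_def)
    ultimately show "P $$ (i, j) = (F * P * F\<^sup>T + G) $$ (i, j)"
      using sums[OF ij] sums_unique2 ij Gc F P by fastforce
  qed (use F P Gc in auto)
  moreover have "psd n P"
    unfolding psd_def
  proof (intro conjI ballI)
    have "T k $$ (j, i) = T k $$ (i, j)" if "i < n" "j < n" for k i j
    proof -
      have "(T k)\<^sup>T = T k" using psdT[of k] by (simp add: psd_def)
      moreover have "(T k)\<^sup>T $$ (i, j) = T k $$ (j, i)" using that carrier_matD[OF T[of k]] by simp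
      ultimately show ?thesis by simp
    qed
    then show "P\<^sup>T = P" by (intro eq_matI) (auto simp: P_def)
    fix v :: "real vec" assume v: "v \<in> carrier_vec n"
    have "(\<lambda>k. v \<bullet> (T k *\<^sub>v v)) sums (v \<bullet> (P *\<^sub>v v))"
      unfolding quadratic_form_sum[OF T v] quadratic_form_sum[OF P v]
      by (intro sums_sum sums_mult sums_mult2 sums) simp_all
    moreover have "0 \<le> v \<bullet> (T k *\<^sub>v v)" for k using psdT v by (simp add: psd_def)
    ultimately show "0 \<le> v \<bullet> (P *\<^sub>v v)"
      by (metis suminf_nonneg sums_iff)
  qed (rule P)
  ultimately show ?thesis by blast
qed

text \<open>The Cayley transform \<open>(I/2 - A)\<^sup>-\<^sup>1 (I/2 + A)\<close> maps the open left half plane into the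
  open unit disc and turns the Lyapunov equation into a Stein equation.\<close>

lemma lyapunov_equation_solution:
  assumes A: "A \<in> carrier_mat n n" and B: "B \<in> carrier_mat n m"
    and stable: "asymptotically_stable A"
  shows "\<exists>P. psd n P \<and> A * P + P * A\<^sup>T + B * B\<^sup>T = 0\<^sub>m n n"
proof -
  \<comment> \<open>The constant 1/2 makes \<open>N * P * N\<^sup>T - M * P * M\<^sup>T\<close>
    equal to \<open>- (A * P + P * A\<^sup>T)\<close> with no scalar in front.\<close>
  define N where "N = (1/2) \<cdot>\<^sub>m 1\<^sub>m n - A"
  define M where "M = (1/2) \<cdot>\<^sub>m 1\<^sub>m n + A"
  have N: "N \<in> carrier_mat n n" and M: "M \<in> carrier_mat n n" using A by (auto simp: N_def M_def)
  have "det N \<noteq> 0"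
  proof
    assume "det N = 0"
    then obtain v where v: "v \<in> carrier_vec n" "v \<noteq> 0\<^sub>v n" and Nv: "N *\<^sub>v v = 0\<^sub>v n"
      using det_0_iff_vec_prod_zero[OF N] by auto
    have "A *\<^sub>v v = (1/2) \<cdot>\<^sub>v v"
    proof (rule eq_vecI)
      fix i assume "i < dim_vec ((1/2) \<cdot>\<^sub>v v)"
      then have i: "i < n" using v by simp
      have "((1/2) \<cdot>\<^sub>m 1\<^sub>m n *\<^sub>v v - A *\<^sub>v v) $ i = 0"
        using Nv A v i unfolding N_def by (simp add: minus_mult_distrib_mat_vec[of _ n n])
      moreover have "((1/2) \<cdot>\<^sub>m 1\<^sub>m n *\<^sub>v v) $ i = v $ i / 2"
        using v i by simp
      ultimately show "(A *\<^sub>v v) $ i = ((1/2) \<cdot>\<^sub>v v) $ i" using A v i by simp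
    qed (use A v in auto)
    then have "eigenvalue A (1/2)" using v A unfolding eigenvalue_def eigenvector_def by auto
    from of_real_hom.eigenvalue_hom[OF A this] stable show False
      unfolding asymptotically_stable_def by fastforce
  qed
  then obtain E where E: "E \<in> carrier_mat n n" and EN: "E * N = 1\<^sub>m n" and NE: "N * E = 1\<^sub>m n"
    using det_nonzero_inverse[OF N] by blast
  define F where "F = E * M"
  have F: "F \<in> carrier_mat n n" using E M by (simp add: F_def)
  have NF: "N * F = M" using assoc_mult_mat[OF N E M] M by (simp add: F_def NE)
  have norm_lt: "norm z < 1" if ez: "eigenvalue (complex_mat F) z" for z
  proof -
    let ?A = "complex_mat A" and ?F = "complex_mat F" and ?N = "complex_mat N" and ?M = "complex_mat M"
    obtain v where v: "v \<in> carrier_vec n" "v \<noteq> 0\<^sub>v n" and Fv: "?F *\<^sub>v v = z \<cdot>\<^sub>v v"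
      using ez F unfolding eigenvalue_def eigenvector_def by auto
    have "?M = ?N * ?F" using of_real_hom.mat_hom_mult[OF N F] by (simp add: NF)
    then have MN: "?M *\<^sub>v v = z \<cdot>\<^sub>v (?N *\<^sub>v v)"
      using N F v by (simp add: assoc_mult_mat_vec[of _ n n _ n] Fv mult_mat_vec[of _ n n])
    have eq: "v $ i / 2 + (?A *\<^sub>v v) $ i = z * (v $ i / 2 - (?A *\<^sub>v v) $ i)" if i: "i < n" for i
    proof -
      have "?M = (1/2) \<cdot>\<^sub>m 1\<^sub>m n + ?A" "?N = (1/2) \<cdot>\<^sub>m 1\<^sub>m n - ?A"
        using A by (auto simp: M_def N_def intro!: eq_matI)
      then have "(?M *\<^sub>v v) $ i = v $ i / 2 + (?A *\<^sub>v v) $ i" "(?N *\<^sub>v v) $ i = v $ i / 2 - (?A *\<^sub>v v) $ i"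
        using A v i by (simp_all add: add_mult_distrib_mat_vec[of _ n n] minus_mult_distrib_mat_vec[of _ n n])
      then show ?thesis using MN N v i by (metis carrier_matD(1) dim_mult_mat_vec index_map_mat(2) index_smult_vec(1))
    qed
    \<comment> \<open>An eigenvector of \<open>F\<close> satisfies
      \<open>?M *\<^sub>v v = z \<cdot>\<^sub>v (?N *\<^sub>v v)\<close>. For \<open>z = - 1\<close>
      the terms with \<open>A\<close> cancel and force \<open>v\<close> to be zero; for any other
      \<open>z\<close> the relation can be solved for \<open>A\<close>, giving the eigenvalue
      \<open>w\<close>.\<close>
    have z1: "z \<noteq> - 1"
    proof
      assume "z = - 1"
      then have "v $ i = 0" if "i < n" for i using eq[OF that] by simp
      then show False using v by (metis carrier_vecD eq_vecI index_zero_vec)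
    qed
    define w where "w = (z - 1) / (2 * (z + 1))"
    have "z + 1 \<noteq> 0" using z1 by (simp add: add_eq_0_iff2)
    then have zp: "2 * (z + 1) \<noteq> 0" by (metis mult_eq_0_iff zero_neq_numeral)
    have "?A *\<^sub>v v = w \<cdot>\<^sub>v v"
    proof (rule eq_vecI)
      fix i assume "i < dim_vec (w \<cdot>\<^sub>v v)"
      then have i: "i < n" using v by simp
      have "2 * ((2 * (z + 1)) * (?A *\<^sub>v v) $ i) = 2 * ((z - 1) * v $ i)"
        using eq[OF i] by (simp add: field_simps)
      then have "(?A *\<^sub>v v) $ i * (2 * (z + 1)) = (z - 1) * v $ i"
        by (simp only: mult_cancel_left mult.commute) simp
      then have "(?A *\<^sub>v v) $ i = (z - 1) * v $ i / (2 * (z + 1))"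
        using zp nonzero_eq_divide_eq[of "2 * (z + 1)"] by blast
      then show "(?A *\<^sub>v v) $ i = (w \<cdot>\<^sub>v v) $ i" using v i by (simp add: w_def)
    qed (use A v in auto)
    then have "Re w < 0"
      using stable v A unfolding asymptotically_stable_def eigenvalue_def eigenvector_def by auto
    have "w * (2 * (z + 1)) = z - 1" unfolding w_def using zp nonzero_eq_divide_eq by blast
    moreover have "z * (1 - 2 * w) - (1 + 2 * w) = (z - 1) - w * (2 * (z + 1))"
      by (simp add: algebra_simps)
    ultimately have "z * (1 - 2 * w) = 1 + 2 * w" by simp
    then have "norm z * norm (1 - 2 * w) = norm (1 + 2 * w)" by (simp only: norm_mult[symmetric])
    \<comment> \<open>The squared norms differ by \<open>8 * Re w\<close>, which is
      negative.\<close>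
    moreover have "norm (1 + 2 * w) < norm (1 - 2 * w)"
    proof (rule power2_less_imp_less)
      show "(norm (1 + 2 * w))\<^sup>2 < (norm (1 - 2 * w))\<^sup>2"
        using \<open>Re w < 0\<close> unfolding cmod_power2
        by (simp add: power2_eq_square algebra_simps)
    qed simp
    ultimately have "norm z * norm (1 - 2 * w) < 1 * norm (1 - 2 * w)" by simp
    then show "norm z < 1" by (rule mult_right_less_imp_less) simp
  qed
  \<comment> \<open>Multiplying the Stein equation by \<open>N\<close> on the left and
    \<open>N\<^sup>T\<close> on the right turns this term back into \<open>B * B\<^sup>T\<close>,
    because \<open>N * E\<close> is the identity.\<close>
  define G where "G = (E * B) * (E * B)\<^sup>T"
  have G: "psd n G" using psd_mult_transpose[of "E * B" n m] E B by (simp add: G_def)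
  obtain P where P: "psd n P" and stein: "P = F * P * F\<^sup>T + G"
    using stein_equation_solution[OF F G norm_lt] by blast
  have Pc: "P \<in> carrier_mat n n" and Gc: "G \<in> carrier_mat n n" using P G by (auto simp: psd_def)
  have "N * P * N\<^sup>T = N * (F * P * F\<^sup>T + G) * N\<^sup>T" using stein by simp
  also have "\<dots> = N * (F * P * F\<^sup>T) * N\<^sup>T + N * G * N\<^sup>T"
    using N F Pc Gc by (simp add: mult_add_distrib_mat[of _ n n _ n] add_mult_distrib_mat[of _ n n _ _ n])
  also have "N * (F * P * F\<^sup>T) * N\<^sup>T = (N * F) * P * (N * F)\<^sup>T"
    using N F Pc by (simp add: transpose_mult[of _ n n _ n] assoc_mult_mat[of _ n n _ n _ n])
  also have "N * G * N\<^sup>T = (N * (E * B)) * (N * (E * B))\<^sup>T"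
    using N E B by (simp add: G_def transpose_mult[of _ n n _ m] assoc_mult_mat[of _ n n _ m _ n]
        assoc_mult_mat[of _ n n _ n _ n] assoc_mult_mat[of _ n m _ n _ n])
  also have "N * (E * B) = B" using assoc_mult_mat[OF N E B] B by (simp add: NE)
  finally have eq: "N * P * N\<^sup>T = M * P * M\<^sup>T + B * B\<^sup>T" by (simp add: NF)
  have h: "(1/2 \<cdot>\<^sub>m 1\<^sub>m n) * Y = (1/2) \<cdot>\<^sub>m Y" "Y * (1/2 \<cdot>\<^sub>m 1\<^sub>m n) = (1/2) \<cdot>\<^sub>m Y"
    if "Y \<in> carrier_mat n n" for Y :: "real mat"
    using that by (auto simp: mult_smult_distrib[of _ n n _ n] mult_smult_assoc_mat[of _ n n _ n])
  have NT: "N\<^sup>T = (1/2) \<cdot>\<^sub>m 1\<^sub>m n - A\<^sup>T" and MT: "M\<^sup>T = (1/2) \<cdot>\<^sub>m 1\<^sub>m n + A\<^sup>T"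
    using A by (auto simp: N_def M_def intro!: eq_matI)
  have AP: "A * P \<in> carrier_mat n n" using A Pc by simp
  have hP: "(1/2) \<cdot>\<^sub>m P \<in> carrier_mat n n" and hI: "(1/2 :: real) \<cdot>\<^sub>m 1\<^sub>m n \<in> carrier_mat n n"
    and AT: "A\<^sup>T \<in> carrier_mat n n"
    using A Pc by auto
  define Y where "Y = (1/2) \<cdot>\<^sub>m P - A * P"
  define Z where "Z = (1/2) \<cdot>\<^sub>m P + A * P"
  have Y: "Y \<in> carrier_mat n n" unfolding Y_def by (rule minus_carrier_mat[OF AP])
  have Z: "Z \<in> carrier_mat n n" unfolding Z_def by (rule add_carrier_mat[OF AP])
  have "N * P = Y"
    unfolding N_def Y_def minus_mult_distrib_mat[OF hI A Pc] h[OF Pc] ..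
  then have "N * P * N\<^sup>T = (1/2) \<cdot>\<^sub>m Y - Y * A\<^sup>T"
    unfolding NT by (simp only: mult_minus_distrib_mat[OF Y hI AT] h[OF Y])
  then have N_eq: "N * P * N\<^sup>T = (1/2) \<cdot>\<^sub>m Y - ((1/2) \<cdot>\<^sub>m (P * A\<^sup>T) - A * P * A\<^sup>T)"
    unfolding Y_def minus_mult_distrib_mat[OF hP AP AT] mult_smult_assoc_mat[OF Pc AT] .
  have "M * P = Z"
    unfolding M_def Z_def add_mult_distrib_mat[OF hI A Pc] h[OF Pc] ..
  then have "M * P * M\<^sup>T = (1/2) \<cdot>\<^sub>m Z + Z * A\<^sup>T"
    unfolding MT by (simp only: mult_add_distrib_mat[OF Z hI AT] h[OF Z])
  then have M_eq: "M * P * M\<^sup>T = (1/2) \<cdot>\<^sub>m Z + ((1/2) \<cdot>\<^sub>m (P * A\<^sup>T) + A * P * A\<^sup>T)"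
    unfolding Z_def add_mult_distrib_mat[OF hP AP AT] mult_smult_assoc_mat[OF Pc AT] .
  have "A * P + P * A\<^sup>T + B * B\<^sup>T = 0\<^sub>m n n"
  proof (rule eq_matI)
    fix i j assume "i < dim_row (0\<^sub>m n n)" "j < dim_col (0\<^sub>m n n)"
    then have ij: "i < n" "j < n" by auto
    \<comment> \<open>In terms of these five reals the equation is linear; the quarter of
      \<open>a\<close> and the term \<open>d\<close> occur on both sides and cancel.\<close>
    define a b c d e where "a = P $$ (i, j)" and "b = (A * P) $$ (i, j)" and "c = (P * A\<^sup>T) $$ (i, j)"
      and "d = (A * P * A\<^sup>T) $$ (i, j)" and "e = (B * B\<^sup>T) $$ (i, j)"
    have "(N * P * N\<^sup>T) $$ (i, j) = 1/2 * (1/2 * a - b) - (1/2 * c - d)"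
      unfolding N_eq Y_def a_def b_def c_def d_def using ij A Pc by (simp del: index_mult_mat(1))
    moreover have "(M * P * M\<^sup>T + B * B\<^sup>T) $$ (i, j) = 1/2 * (1/2 * a + b) + (1/2 * c + d) + e"
      unfolding M_eq Z_def a_def b_def c_def d_def e_def using ij A Pc B by (simp del: index_mult_mat(1))
    ultimately have "b + c + e = 0" using eq by (simp add: field_simps)
    then show "(A * P + P * A\<^sup>T + B * B\<^sup>T) $$ (i, j) = 0\<^sub>m n n $$ (i, j)"
      unfolding b_def c_def e_def using ij A Pc B by (simp del: index_mult_mat(1))
  qed (use A Pc B in auto)
  then show ?thesis using P by blast
qed

section \<open>Uniqueness and identification of the Gramians\<close>

lemma asymptotically_stable_transpose:
  assumes A: "A \<in> carrier_mat n n" and stable: "asymptotically_stable A"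
  shows "asymptotically_stable A\<^sup>T"
proof -
  have cA: "complex_mat A \<in> carrier_mat n n" using A by simp
  then have "eigenvalue (complex_mat A)\<^sup>T z = eigenvalue (complex_mat A) z" for z
    by (simp add: eigenvalue_root_char_poly[of _ n] char_poly_transpose_mat)
  moreover have "complex_mat A\<^sup>T = (complex_mat A)\<^sup>T" by (auto intro!: eq_matI)
  ultimately show ?thesis using stable by (simp add: asymptotically_stable_def)
qed

text \<open>The difference \<open>Z\<close> of two solutions satisfies
  \<open>A * Z = - (Z * A\<^sup>T)\<close>. By stability, \<open>z\<close> and \<open>- z\<close>
  cannot be eigenvalues of \<open>A\<^sup>T\<close> and \<open>A\<close> at once, so the Sylvester
  lemma over the complex numbers makes \<open>Z\<close> vanish.\<close>

lemma lyapunov_equation_unique: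
  assumes A: "A \<in> carrier_mat n n" and stable: "asymptotically_stable A"
    and P: "P \<in> carrier_mat n n" "A * P + P * A\<^sup>T + W = 0\<^sub>m n n"
    and Q: "Q \<in> carrier_mat n n" "A * Q + Q * A\<^sup>T + W = 0\<^sub>m n n"
    and W: "W \<in> carrier_mat n n"
  shows "P = Q"
proof -
  define Z where "Z = P - Q"
  have Z: "Z \<in> carrier_mat n n" unfolding Z_def by (rule minus_carrier_mat[OF Q(1)])
  have AZ: "A * Z = - (Z * A\<^sup>T)"
  proof (rule eq_matI)
    fix i j assume "i < dim_row (- (Z * A\<^sup>T))" "j < dim_col (- (Z * A\<^sup>T))"
    then have ij: "i < n" "j < n" using A Z by auto
    have "(A * P + P * A\<^sup>T + W) $$ (i, j) = 0" "(A * Q + Q * A\<^sup>T + W) $$ (i, j) = 0"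
      using P(2) Q(2) ij by auto
    then have "(A * P) $$ (i, j) + (P * A\<^sup>T) $$ (i, j) = (A * Q) $$ (i, j) + (Q * A\<^sup>T) $$ (i, j)"
      using ij A P(1) Q(1) W by (simp del: index_mult_mat(1))
    moreover have "A * Z = A * P - A * Q" "Z * A\<^sup>T = P * A\<^sup>T - Q * A\<^sup>T"
      using A P(1) Q(1) by (auto simp: Z_def mult_minus_distrib_mat[of _ n n _ n] minus_mult_distrib_mat[of _ n n _ _ n])
    ultimately show "(A * Z) $$ (i, j) = (- (Z * A\<^sup>T)) $$ (i, j)"
      using ij A P(1) Q(1) by (simp del: index_mult_mat(1))
  qed (use A Z in auto)
  have "complex_mat A * complex_mat Z = complex_mat (A * Z)"
    by (rule of_real_hom.mat_hom_mult[OF A Z, symmetric])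
  also have "\<dots> = - complex_mat (Z * A\<^sup>T)" unfolding AZ by (auto intro!: eq_matI)
  also have "\<dots> = - (complex_mat Z * complex_mat A\<^sup>T)"
    using of_real_hom.mat_hom_mult[OF Z, of "A\<^sup>T" n] A by simp
  finally have "complex_mat Z = 0\<^sub>m n n"
    using A Z stable asymptotically_stable_transpose[OF A stable]
    by (intro sylvester_unique[of "complex_mat A" n "complex_mat A\<^sup>T"])
      (fastforce simp: asymptotically_stable_def)+
  then have "Z $$ (i, j) = 0" if "i < n" "j < n" for i j
    using that Z by (metis carrier_matD index_map_mat(1) index_zero_mat(1) of_real_eq_0_iff)
  then show ?thesis
    using P(1) Q(1) by (intro eq_matI) (auto simp: Z_def)
qed

lemma controllability_gramian_eq:
  assumes A: "A \<in> carrier_mat n n" and B: "B \<in> carrier_mat n m" and stable: "asymptotically_stable A"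
    and P: "P \<in> carrier_mat n n" "A * P + P * A\<^sup>T + B * B\<^sup>T = 0\<^sub>m n n"
  shows "controllability_gramian n A B = P"
  unfolding controllability_gramian_def
proof (rule the_equality)
  fix Q assume Q: "Q \<in> carrier_mat n n \<and> A * Q + Q * A\<^sup>T + B * B\<^sup>T = 0\<^sub>m n n"
  have "B * B\<^sup>T \<in> carrier_mat n n" using B by auto
  with Q show "Q = P" using lyapunov_equation_unique[OF A stable _ _ P] by blast
qed (use P in blast)

text \<open>Duality: the defining equation is the controllability equation of the pair
  \<open>A\<^sup>T\<close>, \<open>L\<^sup>T\<close>.\<close>

lemma observability_gramian_eq:
  assumes A: "A \<in> carrier_mat n n" and L: "L \<in> carrier_mat q n" and stable: "asymptotically_stable A"
    and Q: "Q \<in> carrier_mat n n" "A\<^sup>T * Q + Q * A + L\<^sup>T * L = 0\<^sub>m n n"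
  shows "observability_gramian n A L = Q"
proof -
  have AT: "A\<^sup>T \<in> carrier_mat n n" and LT: "L\<^sup>T \<in> carrier_mat n q" using A L by auto
  have "controllability_gramian n A\<^sup>T L\<^sup>T = Q"
    using controllability_gramian_eq[OF AT LT asymptotically_stable_transpose[OF A stable] Q(1)] Q(2)
    by (simp only: transpose_transpose)
  then show ?thesis
    by (simp only: controllability_gramian_def observability_gramian_def transpose_transpose)
qed

lemma kyp_solution_is_observability_gramian:
  assumes sys: "lti_system n m m A B C D" and stable: "asymptotically_stable A"
    and X: "X \<in> carrier_mat n n" and fac: "spectral_factor n m q A B C D X L M"
  shows "observability_gramian n A L = X"
proof -
  have A: "A \<in> carrier_mat n n" and B: "B \<in> carrier_mat n m"
    and C: "C \<in> carrier_mat m n" and D: "D \<in> carrier_mat m m"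
    and L: "L \<in> carrier_mat q n" and M: "M \<in> carrier_mat q m"
    and W: "kyp_mat A B C D X = (append_cols L M)\<^sup>T * append_cols L M"
    using sys fac by (auto simp: lti_system_def spectral_factor_def)
  have "A\<^sup>T * X + X * A + L\<^sup>T * L = 0\<^sub>m n n"
  proof (rule eq_matI)
    fix i j assume "i < dim_row (0\<^sub>m n n)" "j < dim_col (0\<^sub>m n n)"
    then have ij: "i < n" "j < n" by auto
    \<comment> \<open>Indices below \<open>n\<close> select the upper left block, in which only
      \<open>L\<close> enters on the other side.\<close>
    have "kyp_mat A B C D X $$ (i, j) = - (A\<^sup>T * X) $$ (i, j) - (X * A) $$ (i, j)"
      unfolding kyp_mat_def using ij A X D by (simp del: index_mult_mat(1))
    moreover have "((append_cols L M)\<^sup>T * append_cols L M) $$ (i, j) = (L\<^sup>T * L) $$ (i, j)"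
      unfolding append_cols_def using ij L M by (auto simp: scalar_prod_def intro!: sum.cong)
    ultimately have "- (A\<^sup>T * X) $$ (i, j) - (X * A) $$ (i, j) = (L\<^sup>T * L) $$ (i, j)"
      using W by simp
    then show "(A\<^sup>T * X + X * A + L\<^sup>T * L) $$ (i, j) = 0\<^sub>m n n $$ (i, j)"
      using ij A X L by (simp del: index_mult_mat(1))
  qed (use A X L in auto)
  then show ?thesis using observability_gramian_eq[OF A L stable X] by simp
qed

theorem theorem3p6:
  fixes n m q q' :: nat
    and A B C D Xmin X L M L' M' :: "real mat"
  assumes "lti_system n m m A B C D"
    and "passive_system n m A B C D"
    and "minimal_system n A B C"
    and "asymptotically_stable A"
    and "minimal_kyp_solution n m A B C D Xmin"
    and "spectral_factor n m q A B C D Xmin L M"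
    and "kyp_solution n m A B C D X"
    and "spectral_factor n m q' A B C D X L' M'"
  shows "\<forall>k \<in> {1..n}. hankel_singular_value n A B L k \<le> hankel_singular_value n A B L' k"
proof
  fix k assume k: "k \<in> {1..n}"
  then have k': "k - 1 < n" by auto
  have A: "A \<in> carrier_mat n n" and B: "B \<in> carrier_mat n m"
    using assms(1) by (auto simp: lti_system_def)
  have Xmin: "Xmin \<in> carrier_mat n n" "Xmin\<^sup>T = Xmin" and X: "X \<in> carrier_mat n n" "X\<^sup>T = X"
    and le: "psd n (X - Xmin)"
    using assms(5,7) by (auto simp: minimal_kyp_solution_def kyp_solution_def)
  obtain P where P: "psd n P" and lyap: "A * P + P * A\<^sup>T + B * B\<^sup>T = 0\<^sub>m n n"
    using lyapunov_equation_solution[OF A B assms(4)] by blast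
  have "controllability_gramian n A B = P"
    using controllability_gramian_eq[OF A B assms(4) _ lyap] P by (simp add: psd_def)
  moreover have "observability_gramian n A L = Xmin" "observability_gramian n A L' = X"
    using kyp_solution_is_observability_gramian[OF assms(1,4)] Xmin(1) X(1) assms(6,8) by auto
  \<comment> \<open>The real \<open>sqrt\<close> is monotone on the whole line, so comparing the
    list entries at \<open>k - 1\<close> is enough; the shift reconciles counting from 1 with list
    positions from 0.\<close>
  ultimately show "hankel_singular_value n A B L k \<le> hankel_singular_value n A B L' k"
    using sorted_eigenvalues_psd_mult_mono[OF P Xmin X le, of "k - 1"] k'
    by (simp add: hankel_singular_value_def)
qed

end
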